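(* Let $k,w,s,n\in\mathbb Z_{>0}$ and let $g,h$ be integers with $0\le g<h\le s$. Suppose that $n\ge\ell\bigl(\delta_{k,h}^{(w,s)}\bigr)$. Then \[ \frac{s_{\delta_{k,h}^{(w,s)}}(\mathbf 1_n)} {s_{\delta_{k,g}^{(w,s)}}(\mathbf 1_n)} = \prod_{r=0}^{k-1}\prod_{j=1}^{w}\prod_{v=0}^{h-g-1} \frac{n-s(k-1)-h+sr+v+j+wr} {g+sr+v+j+wr}. \]
   Context: Partitions are weakly decreasing sequences of nonnegative integers with finitely many nonzero parts; $\ell(\lambda)$ is the number of nonzero parts. Exponents on parts denote multiplicities; a part with multiplicity $0$ is omitted. Intermediate generalized staircase partitions: for $w,s\in\mathbb Z_{>0}$ and $0\le g\le s$, $\delta_{1,g}^{(w,s)}=(w^g)$ (with $\delta_{1,0}^{(w,s)}=\varnothing$) and, for $k\ge2$, $\delta_{k,g}^{(w,s)}=\bigl((wk)^g,(w(k-1))^s,(w(k-2))^s,\ldots,w^s\bigr)$. One has $\ell(\delta_{k,g}^{(w,s)})=s(k-1)+g$. $s_\lambda$ (with a partition as subscript) is the Schur polynomial, not to be confused with the integer $s$; $\mathbf 1_n=(1,\ldots,1)$ ($n$ entries). Thus $s_\lambda(\mathbf 1_n)$ is the number of semistandard Young tableaux (rows weakly increasing, columns strictly increasing) of shape $\lambda$ with entries in $\{1,\ldots,n\}$. *)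

theory Defs
  imports Complex_Main "HOL-Library.FuncSet"
begin

text \<open>Partitions are infinite sequences, with parts indexed from 0.\<close>

definition is_partition :: "(nat \<Rightarrow> nat) \<Rightarrow> bool" where
  "is_partition \<mu> \<longleftrightarrow> antimono \<mu> \<and> finite {i. \<mu> i \<noteq> 0}"

definition part_length :: "(nat \<Rightarrow> nat) \<Rightarrow> nat" where
  "part_length \<mu> = card {i. \<mu> i \<noteq> 0}"

definition partition_of_list :: "nat list \<Rightarrow> nat \<Rightarrow> nat" where
  "partition_of_list xs i = (if i < length xs then xs ! i else 0)"

text \<open>
  The intermediate generalized staircase \<open>((w k)^g, (w (k - 1))^s, ..., w^s)\<close>; for \<open>k = 1\<close>
  the list \<open>rev [1..<k]\<close> is empty, which leaves \<open>(w^g)\<close>.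
\<close>

definition staircase :: "nat \<Rightarrow> nat \<Rightarrow> nat \<Rightarrow> nat \<Rightarrow> nat \<Rightarrow> nat" where
  "staircase w s k g =
     partition_of_list
       (replicate g (w * k) @ concat (map (\<lambda>i. replicate s (w * i)) (rev [1..<k])))"

definition young_diagram :: "(nat \<Rightarrow> nat) \<Rightarrow> (nat \<times> nat) set" where
  "young_diagram \<mu> = {(i, j). j < \<mu> i}"

text \<open>
  A tableau is a function on cells (row, column), fixed to be \<open>undefined\<close> off the diagram so
  that distinct functions are distinct tableaux.
\<close>

definition ssyt :: "nat \<Rightarrow> (nat \<Rightarrow> nat) \<Rightarrow> (nat \<times> nat \<Rightarrow> nat) set" where
  "ssyt n \<mu> =
     {T \<in> young_diagram \<mu> \<rightarrow>\<^sub>E {1..n}.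
        (\<forall>i j j'. (i, j) \<in> young_diagram \<mu> \<and> (i, j') \<in> young_diagram \<mu> \<and> j < j'
           \<longrightarrow> T (i, j) \<le> T (i, j')) \<and>
        (\<forall>i i' j. (i, j) \<in> young_diagram \<mu> \<and> (i', j) \<in> young_diagram \<mu> \<and> i < i'
           \<longrightarrow> T (i, j) < T (i', j))}"

text \<open>
  The value of the Schur polynomial in \<open>n\<close> variables at \<open>(x 1, ..., x n)\<close>.
\<close>

definition schur :: "nat \<Rightarrow> (nat \<Rightarrow> nat) \<Rightarrow> (nat \<Rightarrow> 'a::comm_semiring_1) \<Rightarrow> 'a" where
  "schur n \<mu> x = (\<Sum>T\<in>ssyt n \<mu>. \<Prod>c\<in>young_diagram \<mu>. x (T c))"

lemma schur_ones: "schur n \<mu> (\<lambda>_. 1) = of_nat (card (ssyt n \<mu>))"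
  by (simp add: schur_def)

lemma finite_young_diagram:
  assumes "is_partition \<mu>"
  shows "finite (young_diagram \<mu>)"
proof -
  have "young_diagram \<mu> = (SIGMA i:{i. \<mu> i \<noteq> 0}. {..<\<mu> i})"
    by (auto simp: young_diagram_def)
  then show ?thesis
    using assms by (simp add: is_partition_def)
qed

lemma finite_ssyt:
  assumes "is_partition \<mu>"
  shows "finite (ssyt n \<mu>)"
proof -
  have "finite (young_diagram \<mu> \<rightarrow>\<^sub>E {1..n})"
    by (intro finite_PiE finite_young_diagram assms) auto
  then show ?thesis
    by (rule rev_finite_subset) (auto simp: ssyt_def)
qed

lemma is_partition_partition_of_list:
  assumes "sorted_wrt (\<ge>) xs"
  shows "is_partition (partition_of_list xs)"
proof -
  have "partition_of_list xs j \<le> partition_of_list xs i" if "i \<le> j" for i j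
    using that assms
    by (cases "i = j") (auto simp: partition_of_list_def sorted_wrt_iff_nth_less)
  moreover have "finite {i. partition_of_list xs i \<noteq> 0}"
    by (rule finite_subset[of _ "{..<length xs}"]) (auto simp: partition_of_list_def)
  ultimately show ?thesis
    by (simp add: is_partition_def monotone_def)
qed

lemma is_partition_staircase: "is_partition (staircase w s k g)"
proof -
  have rep: "sorted_wrt (\<ge>) (replicate m (a::nat))" for m a
    by (induction m) auto
  have "sorted_wrt (\<ge>) (concat (map (\<lambda>i. replicate s (w * i)) (rev [1..<k])))"
    by (induction k) (auto simp: sorted_wrt_append rep)
  then show ?thesis
    unfolding staircase_def
    by (intro is_partition_partition_of_list) (auto simp: sorted_wrt_append rep)
qed

lemma part_length_staircase:
  assumes "w > 0" "k > 0"
  shows "part_length (staircase w s k g) = s * (k - 1) + g"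
proof -
  define xs where
    "xs = replicate g (w * k) @ concat (map (\<lambda>i. replicate s (w * i)) (rev [1..<k]))"
  have "0 \<notin> set xs"
    using assms by (auto simp: xs_def)
  then have "{i. partition_of_list xs i \<noteq> 0} = {..<length xs}"
    by (auto simp: partition_of_list_def) (metis gr0I nth_mem)
  moreover have "length (concat (map (\<lambda>i. replicate s (w * i)) (rev [1..<k]))) = s * (k - 1)"
    by (simp add: length_concat comp_def rev_map sum_list_triv)
  then have "length xs = s * (k - 1) + g"
    by (simp add: xs_def)
  ultimately show ?thesis
    by (simp add: part_length_def staircase_def xs_def)
qed

end

theory Submission
  imports Defs "Jordan_Normal_Form.Determinant"
begin

text \<open>
  Write \<open>x i = \<nu> i - i\<close>. The number of semistandard tableaux of shape \<open>\<nu>\<close> with entries at most \<open>n\<close>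
  is a constant depending on \<open>n\<close> times the product of the differences \<open>x i - x j\<close> over
  \<open>i < j < n\<close> (\<open>card_ssyt_weyl\<close>). This rests on the branching rule \<open>card_ssyt_Suc\<close>, which counts
  tableaux by the shape left after deleting the largest entry. The resulting sum over interlacing
  shapes is matched, row by row, by the telescoping of a determinant of binomial coefficients
  (\<open>card_ssyt_eq_det\<close>), and such a determinant is a Vandermonde product
  (\<open>det_polys_eq_vandermonde_prod\<close>).

  Increasing \<open>g\<close> by one prepends a row of length \<open>w * k\<close> to the staircase. In the product of
  differences almost everything cancels: the ratio of the two counts is the product of the differences
  of the new row with all others, divided by the product of the differences of all old rows with an
  empty last row (\<open>card_ssyt_prepend_row\<close>). For a staircase each of these products consists of runs of
  consecutive integers, one for each block of equal rows, separated by gaps of length \<open>w\<close>. Filling the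
  gaps completes both products to the same factorial (\<open>prod_first_row_factors\<close>,
  \<open>prod_last_row_factors\<close>), so the ratio is the quotient of the two gap products. These are the
  numerators and denominators of the claimed formula for a single step, and multiplying over the
  steps from \<open>g\<close> to \<open>h\<close> gives the general case.
\<close>

section \<open>Determinants\<close>

text \<open>
  Subtracting row \<open>\<sigma> i\<close> from row \<open>i\<close> for all \<open>i < n\<close> clears the last column except for its last entry.
  Because \<open>\<sigma> i > i\<close>, these subtractions are simultaneously multiplication by a unipotent upper
  triangular matrix. Taking \<open>\<sigma> i = Suc i\<close> gives the differences that appear when a sum over
  interlacing rows telescopes; taking \<open>\<sigma>\<close> constantly \<open>n\<close> gives the induction step for
  Vandermonde-type determinants.
\<close>

lemma det_const_last_column:
  fixes a :: "nat \<Rightarrow> nat \<Rightarrow> 'a::comm_ring_1"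
  assumes col: "\<And>i. i \<le> n \<Longrightarrow> a i n = c"
    and \<sigma>: "\<And>i. i < n \<Longrightarrow> i < \<sigma> i \<and> \<sigma> i \<le> n"
  shows "det (mat (Suc n) (Suc n) (\<lambda>(i, j). a i j)) =
         c * det (mat n n (\<lambda>(i, j). a i j - a (\<sigma> i) j))"
proof -
  define A where "A = mat (Suc n) (Suc n) (\<lambda>(i, j). a i j)"
  define U :: "'a mat" where
    "U = mat (Suc n) (Suc n)
           (\<lambda>(i, l). (if l = i then 1 else 0) - (if i < n \<and> l = \<sigma> i then 1 else 0))"
  define B where
    "B = mat (Suc n) (Suc n) (\<lambda>(i, j). a i j - (if i < n then a (\<sigma> i) j else 0))"
  have [simp]: "A \<in> carrier_mat (Suc n) (Suc n)" "U \<in> carrier_mat (Suc n) (Suc n)"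
    "B \<in> carrier_mat (Suc n) (Suc n)"
    by (auto simp: A_def U_def B_def)
  have "upper_triangular U"
    unfolding upper_triangular_def U_def using \<sigma> by (force simp: not_less)
  then have "det U = prod_list (diag_mat U)"
    by (rule det_upper_triangular[where n = "Suc n"]) simp
  also have "\<dots> = (\<Prod>i = 0..<Suc n. U $$ (i, i))"
    by (simp add: prod_list_diag_prod U_def)
  also have "\<dots> = 1"
    by (rule prod.neutral) (use \<sigma> in \<open>force simp: U_def\<close>)
  finally have "det U = 1" .
  have "U * A = B"
  proof (rule eq_matI)
    fix i j assume "i < dim_row B" "j < dim_col B"
    then have ij: "i < Suc n" "j < Suc n"
      by (auto simp: B_def)
    have "(U * A) $$ (i, j) = (\<Sum>l = 0..<Suc n. U $$ (i, l) * A $$ (l, j))"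
      using ij by (simp add: scalar_prod_def A_def U_def)
    also have "\<dots> = (\<Sum>l = 0..<Suc n. (if l = i then a l j else 0)
                         - (if l = \<sigma> i then if i < n then a l j else 0 else 0))"
      using ij by (intro sum.cong) (auto simp: A_def U_def)
    also have "\<dots> = B $$ (i, j)"
      using ij \<sigma>[of i] by (cases "i = n") (auto simp: sum_subtractf B_def)
    finally show "(U * A) $$ (i, j) = B $$ (i, j)" .
  qed (auto simp: A_def B_def U_def)
  then have "det A = det B"
    using det_mult[of U "Suc n" A] \<open>det U = 1\<close> by simp
  also have "\<dots> = (\<Sum>i<Suc n. B $$ (i, n) * cofactor B i n)"
    by (rule laplace_expansion_column) auto
  also have "\<dots> = c * cofactor B n n"
    using col \<sigma> by (simp add: B_def)
  also have "cofactor B n n = det (mat_delete B n n)"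
    by (simp add: cofactor_def)
  also have "mat_delete B n n = mat n n (\<lambda>(i, j). a i j - a (\<sigma> i) j)"
    by (rule eq_matI) (auto simp: mat_delete_def B_def)
  finally show ?thesis
    by (simp add: A_def)
qed

lemma det_scale_rows:
  fixes b :: "nat \<Rightarrow> nat \<Rightarrow> 'a::comm_ring_1"
  shows "det (mat n n (\<lambda>(i, j). d i * b i j)) = (\<Prod>i<n. d i) * det (mat n n (\<lambda>(i, j). b i j))"
proof -
  have "(\<Prod>i = 0..<n. d i * b i (p i)) = (\<Prod>i<n. d i) * (\<Prod>i = 0..<n. b i (p i))" for p
    by (simp add: prod.distrib atLeast0LessThan)
  then show ?thesis
    by (auto simp: det_def sum_distrib_left mult_ac permutes_in_image intro!: sum.cong)
qed

text \<open>
  This is multilinearity in the rows: in the Leibniz expansion, a product of sums becomes a sum over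
  choice functions.
\<close>

lemma det_sum_rows:
  fixes f :: "nat \<Rightarrow> nat \<Rightarrow> 'b \<Rightarrow> 'a::comm_ring_1"
  assumes "\<And>i. i < n \<Longrightarrow> finite (S i)"
  shows "det (mat n n (\<lambda>(i, j). \<Sum>m\<in>S i. f i j m)) =
         (\<Sum>m\<in>PiE {..<n} S. det (mat n n (\<lambda>(i, j). f i j (m i))))"
proof -
  have "(\<Prod>i = 0..<n. \<Sum>m\<in>S i. f i (p i) m) = (\<Sum>m\<in>PiE {..<n} S. \<Prod>i<n. f i (p i) (m i))" for p
    unfolding atLeast0LessThan by (rule prod_sum_PiE) (use assms in auto)
  then have "det (mat n n (\<lambda>(i, j). \<Sum>m\<in>S i. f i j m)) =
      (\<Sum>p | p permutes {0..<n}. \<Sum>m\<in>PiE {..<n} S. signof p * (\<Prod>i<n. f i (p i) (m i)))"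
    by (auto simp: det_def sum_distrib_left permutes_in_image intro!: sum.cong)
  also have "\<dots> = (\<Sum>m\<in>PiE {..<n} S. \<Sum>p | p permutes {0..<n}. signof p * (\<Prod>i<n. f i (p i) (m i)))"
    by (rule sum.swap)
  finally show ?thesis
    by (simp add: det_def permutes_in_image atLeast0LessThan)
qed

text \<open>
  Only the leading coefficients of the polynomials matter. The last column is constant, so subtracting
  the last row from the others lowers the size by one and replaces \<open>p\<close> by \<open>p - p (x n)\<close>. Dividing
  row \<open>i\<close> by \<open>x i - x n\<close> leaves the quotients of synthetic division, which again have degree at most
  their index and the same leading coefficients.
\<close>

lemma det_polys_eq_vandermonde_prod:
  fixes p :: "nat \<Rightarrow> 'a::{comm_ring_1,ring_no_zero_divisors} poly"
  assumes "\<And>q. degree (p q) \<le> q"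
  shows "det (mat n n (\<lambda>(i, j). poly (p (n - 1 - j)) (x i))) =
         (\<Prod>q<n. coeff (p q) q) * (\<Prod>j<n. \<Prod>i<j. x i - x j)"
  using assms
proof (induction n arbitrary: p)
  case 0
  show ?case by simp
next
  case (Suc n)
  define r where "r q = synthetic_div (p (Suc q)) (x n)" for q
  have deg: "degree (r q) \<le> q" for q
    using Suc.prems[of "Suc q"] by (simp add: r_def degree_synthetic_div)
  have r: "p (Suc q) = [:- x n, 1:] * r q + [:poly (p (Suc q)) (x n):]" for q
    unfolding r_def by (metis synthetic_div_correct')
  have coeff: "coeff (r q) q = coeff (p (Suc q)) (Suc q)" for q
    by (subst r) (use deg[of q] in \<open>simp add: coeff_eq_0\<close>)
  have diff: "poly (p (Suc q)) y - poly (p (Suc q)) (x n) = (y - x n) * poly (r q) y" for q y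
    by (subst (1) r) (simp add: algebra_simps)
  have "degree (p 0) = 0"
    using Suc.prems[of 0] by simp
  then have "poly (p 0) y = coeff (p 0) 0" for y
    using degree0_coeffs[of "p 0"] by auto
  then have "det (mat (Suc n) (Suc n) (\<lambda>(i, j). poly (p (Suc n - 1 - j)) (x i))) =
      coeff (p 0) 0 * det (mat n n (\<lambda>(i, j). poly (p (n - j)) (x i) - poly (p (n - j)) (x n)))"
    by (subst det_const_last_column[where c = "coeff (p 0) 0" and \<sigma> = "\<lambda>_. n"]) auto
  also have "mat n n (\<lambda>(i, j). poly (p (n - j)) (x i) - poly (p (n - j)) (x n)) =
             mat n n (\<lambda>(i, j). (x i - x n) * poly (r (n - 1 - j)) (x i))"
  proof (rule cong_mat; clarsimp)
    fix i j assume "j < n"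
    then have "n - j = Suc (n - Suc j)" by simp
    then show "poly (p (n - j)) (x i) - poly (p (n - j)) (x n) =
        (x i - x n) * poly (r (n - Suc j)) (x i)"
      by (metis diff)
  qed
  also have "det \<dots> = (\<Prod>i<n. x i - x n) *
      ((\<Prod>q<n. coeff (r q) q) * (\<Prod>j<n. \<Prod>i<j. x i - x j))"
    by (subst det_scale_rows, subst Suc.IH[OF deg]) simp
  also have "(\<Prod>q<n. coeff (r q) q) = (\<Prod>q<n. coeff (p (Suc q)) (Suc q))"
    by (simp add: coeff)
  finally show ?case
    by (simp only: prod.lessThan_Suc_shift[of "\<lambda>q. coeff (p q) q"] prod.lessThan_Suc mult_ac)
qed

section \<open>Branching of semistandard tableaux\<close>

definition truncate_rows :: "nat \<Rightarrow> (nat \<Rightarrow> nat) \<Rightarrow> nat \<Rightarrow> nat" where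
  "truncate_rows n m i = (if i < n then m i else 0)"

text \<open>
  The inverse of deleting the entries \<open>Suc n\<close> from a tableau: \<open>T\<close> lives on the inner shape \<open>\<mu>\<close>, and
  all cells between \<open>\<mu>\<close> and the outer shape \<open>\<nu>\<close> receive the largest entry \<open>Suc n\<close>.
\<close>

definition fill_strip ::
    "nat \<Rightarrow> (nat \<Rightarrow> nat) \<Rightarrow> (nat \<Rightarrow> nat) \<Rightarrow> (nat \<times> nat \<Rightarrow> nat) \<Rightarrow> nat \<times> nat \<Rightarrow> nat" where
  "fill_strip n \<nu> \<mu> T c =
     (if c \<in> young_diagram \<mu> then T c else if c \<in> young_diagram \<nu> then Suc n else undefined)"

lemma ssyt_row_le: "T \<in> ssyt n \<mu> \<Longrightarrow> j < j' \<Longrightarrow> j' < \<mu> i \<Longrightarrow> T (i, j) \<le> T (i, j')"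
  unfolding ssyt_def young_diagram_def by auto

lemma ssyt_col_less:
  "T \<in> ssyt n \<mu> \<Longrightarrow> i < i' \<Longrightarrow> j < \<mu> i \<Longrightarrow> j < \<mu> i' \<Longrightarrow> T (i, j) < T (i', j)"
  unfolding ssyt_def young_diagram_def by auto

lemma ssyt_bounds: "T \<in> ssyt n \<mu> \<Longrightarrow> j < \<mu> i \<Longrightarrow> 1 \<le> T (i, j) \<and> T (i, j) \<le> n"
  unfolding ssyt_def young_diagram_def PiE_def Pi_def by fastforce

lemma ssyt_undefined: "T \<in> ssyt n \<mu> \<Longrightarrow> c \<notin> young_diagram \<mu> \<Longrightarrow> T c = undefined"
  unfolding ssyt_def by (blast intro: PiE_arb)

lemma ssyt_row_index_less:
  assumes "T \<in> ssyt n \<nu>" "antimono \<nu>" "j < \<nu> i"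
  shows "i < T (i, j)"
  using assms(3)
proof (induction i)
  case 0
  with ssyt_bounds[OF assms(1), of j 0] show ?case by simp
next
  case (Suc i)
  have "j < \<nu> i"
    using Suc.prems antimonoD[OF assms(2), of i "Suc i"] by simp
  then show ?case
    using Suc ssyt_col_less[OF assms(1), of i "Suc i" j] by simp
qed

text \<open>
  Columns stay strict because \<open>\<nu> (Suc i) \<le> m i\<close> forces every cell above a cell of \<open>\<nu>\<close> to lie in
  the inner shape, so no column contains two entries \<open>Suc n\<close>.
\<close>

lemma fill_strip_in_ssyt:
  assumes \<nu>: "antimono \<nu>" "\<nu> (Suc n) = 0"
    and m: "\<And>i. i < n \<Longrightarrow> \<nu> (Suc i) \<le> m i \<and> m i \<le> \<nu> i"
    and T: "T \<in> ssyt n (truncate_rows n m)"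
  shows "fill_strip n \<nu> (truncate_rows n m) T \<in> ssyt (Suc n) \<nu>"
proof -
  let ?\<mu> = "truncate_rows n m" and ?F = "fill_strip n \<nu> (truncate_rows n m) T"
  have sub: "?\<mu> i \<le> \<nu> i" for i
    using m by (simp add: truncate_rows_def)
  have above: "j < ?\<mu> i" if "i < i'" "j < \<nu> i'" for i i' j
  proof -
    have "i' < Suc n"
      using that \<nu> antimonoD[OF \<nu>(1), of "Suc n" i'] by (cases "i' < Suc n") auto
    then have "\<nu> (Suc i) \<le> ?\<mu> i"
      using that m by (simp add: truncate_rows_def)
    then show ?thesis
      using that antimonoD[OF \<nu>(1), of "Suc i" i'] by simp
  qed
  have F: "?F (i, j) = (if j < ?\<mu> i then T (i, j) else Suc n)" if "j < \<nu> i" for i j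
    using that by (simp add: fill_strip_def young_diagram_def)
  note bounds = ssyt_bounds[OF T]
  have "?F \<in> young_diagram \<nu> \<rightarrow>\<^sub>E {1..Suc n}"
  proof (rule PiE_I)
    fix c assume "c \<in> young_diagram \<nu>"
    then show "?F c \<in> {1..Suc n}"
      using bounds F by (cases c) (force simp: young_diagram_def)
  next
    fix c assume "c \<notin> young_diagram \<nu>"
    then show "?F c = undefined"
      using sub by (cases c) (auto simp: fill_strip_def young_diagram_def dest: less_le_trans)
  qed
  moreover have "?F (i, j) \<le> ?F (i, j')" if "j < j'" "j' < \<nu> i" for i j j'
    using that bounds[of j i] ssyt_row_le[OF T, of j j' i] by (auto simp: F)
  moreover have "?F (i, j) < ?F (i', j)" if "i < i'" "j < \<nu> i'" "j < \<nu> i" for i i' j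
    using that bounds[of j i] above[OF that(1,2)] ssyt_col_less[OF T, of i i' j] by (auto simp: F)
  ultimately show ?thesis
    by (auto simp: ssyt_def young_diagram_def)
qed

text \<open>
  In each row the entries at most \<open>n\<close> form an initial segment, whose length is \<open>m i\<close>. Strictness of
  the columns gives \<open>\<nu> (Suc i) \<le> m i\<close>, and in row \<open>n\<close> it forces all entries to be \<open>Suc n\<close>, which is
  why the inner shape has at most \<open>n\<close> rows.
\<close>

lemma ssyt_strip_decomposition:
  assumes \<nu>: "antimono \<nu>" "\<nu> (Suc n) = 0" and S: "S \<in> ssyt (Suc n) \<nu>"
  obtains m T where "m \<in> (\<Pi>\<^sub>E i\<in>{..<n}. {\<nu> (Suc i)..\<nu> i})" "T \<in> ssyt n (truncate_rows n m)"
    "S = fill_strip n \<nu> (truncate_rows n m) T"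
proof -
  note bounds = ssyt_bounds[OF S] and row = ssyt_row_le[OF S] and col = ssyt_col_less[OF S]
  define m where
    "m = (\<lambda>i\<in>{..<n}. LEAST l. \<nu> i \<le> l \<or> n < S (i, l))"
  have m_le: "m i \<le> \<nu> i" if "i < n" for i
    using that by (auto simp: m_def intro: Least_le)
  have m_iff: "S (i, j) \<le> n \<longleftrightarrow> j < m i" if "i < n" "j < \<nu> i" for i j
  proof
    assume "j < m i"
    then show "S (i, j) \<le> n"
      using that not_less_Least[of j "\<lambda>l. \<nu> i \<le> l \<or> n < S (i, l)"] by (auto simp: m_def)
  next
    assume le: "S (i, j) \<le> n"
    have "\<nu> i \<le> m i \<or> n < S (i, m i)"
      using that LeastI[of "\<lambda>l. \<nu> i \<le> l \<or> n < S (i, l)" "\<nu> i"] by (simp add: m_def)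
    moreover have "S (i, m i) \<le> S (i, j)" if "m i \<le> j"
      using that row[of "m i" j i] \<open>j < \<nu> i\<close> by (cases "m i = j") auto
    ultimately show "j < m i"
      using le \<open>j < \<nu> i\<close> by force
  qed
  have m_ge: "\<nu> (Suc i) \<le> m i" if "i < n" for i
  proof (rule ccontr)
    assume "\<not> \<nu> (Suc i) \<le> m i"
    then have j: "m i < \<nu> (Suc i)" "m i < \<nu> i"
      using antimonoD[OF \<nu>(1), of i "Suc i"] by auto
    then have "S (i, m i) \<le> n"
      using col[of i "Suc i" "m i"] bounds[of "m i" "Suc i"] by simp
    then show False
      using m_iff[OF that j(2)] by simp
  qed
  let ?\<mu> = "truncate_rows n m"
  define T where "T = restrict S (young_diagram ?\<mu>)"
  have sub: "j < \<nu> i" if "j < ?\<mu> i" for i j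
    using that m_le[of i] by (simp add: truncate_rows_def split: if_splits)
  have small: "S (i, j) \<le> n" if "j < ?\<mu> i" for i j
    using that sub[OF that] m_iff[of i j] by (simp add: truncate_rows_def split: if_splits)
  have "T \<in> ssyt n ?\<mu>"
    using bounds row col sub small
    by (auto simp: ssyt_def T_def young_diagram_def intro!: PiE_I)
  moreover have "S = fill_strip n \<nu> ?\<mu> T"
  proof
    fix c :: "nat \<times> nat"
    obtain i j where c: "c = (i, j)" by (cases c)
    show "S c = fill_strip n \<nu> ?\<mu> T c"
    proof (cases "j < \<nu> i \<and> \<not> j < ?\<mu> i")
      case True
      have "n < S (i, j)"
      proof (cases "i < n")
        case True
        then show ?thesis
          using \<open>j < \<nu> i \<and> \<not> j < ?\<mu> i\<close> m_iff[of i j] by (simp add: truncate_rows_def)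
      next
        case False
        then show ?thesis
          using True ssyt_row_index_less[OF S \<nu>(1), of j i] by simp
      qed
      then have "S (i, j) = Suc n"
        using True bounds[of j i] by simp
      then show ?thesis
        using True by (simp add: c fill_strip_def young_diagram_def)
    next
      case False
      moreover have "S (i, j) = undefined" if "\<not> j < \<nu> i"
        using S that by (auto simp: ssyt_def young_diagram_def PiE_def extensional_def)
      ultimately show ?thesis
        using sub by (auto simp: c fill_strip_def young_diagram_def T_def)
    qed
  qed
  moreover have "m \<in> (\<Pi>\<^sub>E i\<in>{..<n}. {\<nu> (Suc i)..\<nu> i})"
    using m_le m_ge by (intro PiE_I) (auto simp: m_def)
  ultimately show ?thesis
    using that by blast
qed

lemma inj_on_fill_strip:
  "inj_on (\<lambda>(m, T). fill_strip n \<nu> (truncate_rows n m) T)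
     (SIGMA m:(\<Pi>\<^sub>E i\<in>{..<n}. {\<nu> (Suc i)..\<nu> i}). ssyt n (truncate_rows n m))"
proof (rule inj_onI, clarify)
  fix m T m' T'
  assume m: "m \<in> (\<Pi>\<^sub>E i\<in>{..<n}. {\<nu> (Suc i)..\<nu> i})" "m' \<in> (\<Pi>\<^sub>E i\<in>{..<n}. {\<nu> (Suc i)..\<nu> i})"
    and T: "T \<in> ssyt n (truncate_rows n m)" "T' \<in> ssyt n (truncate_rows n m')"
    and eq: "fill_strip n \<nu> (truncate_rows n m) T = fill_strip n \<nu> (truncate_rows n m') T'"
  have recover: "j < l i \<longleftrightarrow> fill_strip n \<nu> (truncate_rows n l) U (i, j) \<le> n"
    if "l \<in> (\<Pi>\<^sub>E i\<in>{..<n}. {\<nu> (Suc i)..\<nu> i})" "U \<in> ssyt n (truncate_rows n l)" "i < n" "j < \<nu> i"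
    for l U i j
    using that ssyt_bounds[OF that(2), of j i]
    by (auto simp: fill_strip_def young_diagram_def truncate_rows_def)
  have "m i = m' i" if "i < n" for i
  proof -
    have "m i \<le> \<nu> i" "m' i \<le> \<nu> i"
      using m that by (auto dest!: PiE_mem[where x = i])
    moreover have "j < m i \<longleftrightarrow> j < m' i" if "j < \<nu> i" for j
      using recover[OF m(1) T(1) \<open>i < n\<close> that] recover[OF m(2) T(2) \<open>i < n\<close> that] eq by simp
    ultimately show ?thesis
      by (metis linorder_neqE_nat less_le_trans less_irrefl)
  qed
  then have mm: "m = m'"
    using m by (intro PiE_ext) auto
  moreover have "T c = T' c" for c
  proof (cases "c \<in> young_diagram (truncate_rows n m)")
    case True
    then show ?thesis
      using fun_cong[OF eq, of c] mm by (simp add: fill_strip_def)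
  next
    case False
    then show ?thesis
      using T mm by (simp add: ssyt_undefined)
  qed
  ultimately show "m = m' \<and> T = T'"
    by auto
qed

lemma antimono_truncate:
  assumes "m \<in> (\<Pi>\<^sub>E i\<in>{..<n}. {\<nu> (Suc i)..\<nu> i})"
  shows "antimono (truncate_rows n m)"
  unfolding decseq_Suc_iff
proof
  fix i
  show "truncate_rows n m (Suc i) \<le> truncate_rows n m i"
  proof (cases "Suc i < n")
    case True
    then have "m (Suc i) \<le> \<nu> (Suc i)" "\<nu> (Suc i) \<le> m i"
      using True PiE_mem[OF assms, of i] PiE_mem[OF assms, of "Suc i"] by auto
    then show ?thesis
      using True by (simp add: truncate_rows_def)
  qed (simp add: truncate_rows_def)
qed

lemma finite_ssyt_truncate:
  assumes "m \<in> (\<Pi>\<^sub>E i\<in>{..<n}. {\<nu> (Suc i)..\<nu> i})"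
  shows "finite (ssyt n (truncate_rows n m))"
proof (rule finite_ssyt)
  have "{i. truncate_rows n m i \<noteq> 0} \<subseteq> {..<n}"
    by (auto simp: truncate_rows_def)
  then show "is_partition (truncate_rows n m)"
    using antimono_truncate[OF assms] finite_subset by (auto simp: is_partition_def)
qed

text \<open>
  The branching rule: deleting the largest entry leaves a tableau whose shape interlaces with \<open>\<nu>\<close>.
\<close>

lemma card_ssyt_Suc:
  assumes \<nu>: "antimono \<nu>" "\<nu> (Suc n) = 0"
  shows "card (ssyt (Suc n) \<nu>) =
         (\<Sum>m \<in> (\<Pi>\<^sub>E i\<in>{..<n}. {\<nu> (Suc i)..\<nu> i}). card (ssyt n (truncate_rows n m)))"
proof -
  let ?M = "\<Pi>\<^sub>E i\<in>{..<n}. {\<nu> (Suc i)..\<nu> i}"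
  let ?F = "\<lambda>(m, T). fill_strip n \<nu> (truncate_rows n m) T"
  have "?F ` (SIGMA m:?M. ssyt n (truncate_rows n m)) = ssyt (Suc n) \<nu>"
  proof (intro equalityI subsetI)
    fix S assume "S \<in> ?F ` (SIGMA m:?M. ssyt n (truncate_rows n m))"
    then obtain m T where "m \<in> ?M" "T \<in> ssyt n (truncate_rows n m)"
      and S: "S = fill_strip n \<nu> (truncate_rows n m) T"
      by auto
    then show "S \<in> ssyt (Suc n) \<nu>"
      unfolding S by (intro fill_strip_in_ssyt \<nu>) (auto dest!: PiE_mem)
  next
    fix S assume "S \<in> ssyt (Suc n) \<nu>"
    then show "S \<in> ?F ` (SIGMA m:?M. ssyt n (truncate_rows n m))"
      by (rule ssyt_strip_decomposition[OF \<nu>]) force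
  qed
  then have "card (ssyt (Suc n) \<nu>) = card (SIGMA m:?M. ssyt n (truncate_rows n m))"
    using card_image[OF inj_on_fill_strip[of n \<nu>]] by simp
  also have "\<dots> = (\<Sum>m\<in>?M. card (ssyt n (truncate_rows n m)))"
    by (intro card_SigmaI finite_PiE ballI finite_ssyt_truncate) auto
  finally show ?thesis .
qed

section \<open>The dimension formula\<close>

lemma sum_choose_interval:
  assumes "a \<le> b"
  shows "(\<Sum>m = a..b. real ((m + d) choose r)) =
         real (Suc (b + d) choose Suc r) - real ((a + d) choose Suc r)"
  using assms by (induction b rule: dec_induct) auto

text \<open>
  In the induction step the branching rule turns row \<open>i\<close> of the smaller matrix into a sum over the
  interval from \<open>\<nu> (Suc i)\<close> to \<open>\<nu> i\<close>. The hockey-stick identity evaluates this to a difference of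
  consecutive rows of the larger matrix, whose last column is constantly \<open>1\<close>.
\<close>

lemma card_ssyt_eq_det:
  assumes "antimono \<nu>" "\<And>i. n \<le> i \<Longrightarrow> \<nu> i = 0"
  shows "real (card (ssyt n \<nu>)) =
         det (mat n n (\<lambda>(i, j). real ((\<nu> i + (n - 1 - i)) choose (n - 1 - j))))"
  using assms
proof (induction n arbitrary: \<nu>)
  case 0
  then have "young_diagram \<nu> = {}"
    by (auto simp: young_diagram_def)
  then have "ssyt 0 \<nu> = {\<lambda>_. undefined}"
    by (auto simp: ssyt_def)
  then show ?case by simp
next
  case (Suc n)
  let ?M = "\<Pi>\<^sub>E i\<in>{..<n}. {\<nu> (Suc i)..\<nu> i}"
  have "real (card (ssyt (Suc n) \<nu>)) = (\<Sum>m\<in>?M. real (card (ssyt n (truncate_rows n m))))"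
    using Suc.prems by (subst card_ssyt_Suc) auto
  also have "\<dots> = (\<Sum>m\<in>?M. det (mat n n (\<lambda>(i, j). real ((m i + (n - 1 - i)) choose (n - 1 - j)))))"
  proof (rule sum.cong)
    fix m assume m: "m \<in> ?M"
    show "real (card (ssyt n (truncate_rows n m))) =
        det (mat n n (\<lambda>(i, j). real ((m i + (n - 1 - i)) choose (n - 1 - j))))"
      by (subst Suc.IH[OF antimono_truncate[OF m]])
         (auto simp: truncate_rows_def intro!: arg_cong[of _ _ det])
  qed simp
  also have "\<dots> = det (mat n n (\<lambda>(i, j).
      \<Sum>m = \<nu> (Suc i)..\<nu> i. real ((m + (n - 1 - i)) choose (n - 1 - j))))"
    by (rule det_sum_rows[symmetric]) simp
  also have "\<dots> = det (mat n n (\<lambda>(i, j).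
      real ((\<nu> i + (n - i)) choose (n - j)) - real ((\<nu> (Suc i) + (n - Suc i)) choose (n - j))))"
    using antimonoD[OF Suc.prems(1)]
    by (intro arg_cong[of _ _ det] cong_mat)
       (auto simp: sum_choose_interval Suc_diff_Suc simp flip: add_Suc_right)
  also have "\<dots> = det (mat (Suc n) (Suc n) (\<lambda>(i, j). real ((\<nu> i + (n - i)) choose (n - j))))"
    by (subst det_const_last_column[where c = 1 and \<sigma> = Suc]) auto
  finally show ?case by simp
qed

text \<open>
  The binomial coefficient \<open>x choose q\<close> as a polynomial in \<open>x\<close>.
\<close>

definition choose_poly :: "nat \<Rightarrow> real poly" where
  "choose_poly q = smult (1 / fact q) (\<Prod>l<q. [:- of_nat l, 1:])"

lemma degree_choose_poly: "degree (choose_poly q) = q"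
  by (simp add: choose_poly_def degree_prod_eq_sum_degree)

lemma coeff_choose_poly: "coeff (choose_poly q) q = 1 / fact q"
proof -
  have "lead_coeff (\<Prod>l<q. [:- of_nat l, 1 :: real:]) = 1"
    by (simp add: lead_coeff_prod)
  moreover have "degree (\<Prod>l<q. [:- of_nat l, 1 :: real:]) = q"
    by (simp add: degree_prod_eq_sum_degree)
  ultimately show ?thesis
    by (simp add: choose_poly_def)
qed

lemma poly_choose_poly: "poly (choose_poly q) (real m) = real (m choose q)"
  by (simp add: choose_poly_def poly_prod binomial_gbinomial gbinomial_prod_rev atLeast0LessThan)

text \<open>
  The Weyl dimension formula in type A. The product of the \<open>1 / fact q\<close> equals the product of all
  \<open>1 / (j - i)\<close> with \<open>i < j < n\<close>; in this form it visibly depends on \<open>n\<close> alone and cancels from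
  ratios.
\<close>

theorem card_ssyt_weyl:
  assumes "antimono \<nu>" "\<And>i. n \<le> i \<Longrightarrow> \<nu> i = 0"
  shows "real (card (ssyt n \<nu>)) =
         (\<Prod>q<n. 1 / fact q) *
         (\<Prod>j<n. \<Prod>i<j. (real (\<nu> i) - real i) - (real (\<nu> j) - real j))"
proof -
  have "real (card (ssyt n \<nu>)) =
        det (mat n n (\<lambda>(i, j). poly (choose_poly (n - 1 - j)) (real (\<nu> i + (n - 1 - i)))))"
    by (simp only: card_ssyt_eq_det[OF assms] poly_choose_poly)
  also have "\<dots> = (\<Prod>q<n. 1 / fact q) *
      (\<Prod>j<n. \<Prod>i<j. real (\<nu> i + (n - 1 - i)) - real (\<nu> j + (n - 1 - j)))"
    by (subst det_polys_eq_vandermonde_prod) (auto simp: degree_choose_poly coeff_choose_poly)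
  also have "(\<Prod>j<n. \<Prod>i<j. real (\<nu> i + (n - 1 - i)) - real (\<nu> j + (n - 1 - j))) =
      (\<Prod>j<n. \<Prod>i<j. (real (\<nu> i) - real i) - (real (\<nu> j) - real j))"
    by (intro prod.cong refl) (auto simp: of_nat_diff)
  finally show ?thesis .
qed

section \<open>Adding a longest row\<close>

lemma card_ssyt_pos:
  assumes "antimono \<nu>" "\<And>i. n \<le> i \<Longrightarrow> \<nu> i = 0"
  shows "0 < card (ssyt n \<nu>)"
proof -
  have "0 < (real (\<nu> i) - real i) - (real (\<nu> j) - real j)" if "i < j" for i j
    using that antimonoD[OF assms(1), of i j] by simp
  then have "0 < real (card (ssyt n \<nu>))"
    by (subst card_ssyt_weyl[OF assms]) (auto intro!: mult_pos_pos prod_pos)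
  then show ?thesis by simp
qed

text \<open>
  With \<open>x i = \<nu> i - i\<close>, prepending a row of length \<open>c\<close> shifts all \<open>x i\<close> by \<open>-1\<close>, which does not
  affect their differences. So the two Vandermonde products share the factors with \<open>i < j < m\<close>. What
  remains is the differences of the new first row with the others on one side, and the differences
  of the old rows with the empty row \<open>m\<close>, which is pushed out, on the other.
\<close>

lemma card_ssyt_prepend_row:
  assumes \<nu>: "antimono \<nu>" "\<And>i. m \<le> i \<Longrightarrow> \<nu> i = 0" and c: "\<nu> 0 \<le> c"
  shows "real (card (ssyt (Suc m) (case_nat c \<nu>))) * (\<Prod>i<m. real m - real i + real (\<nu> i)) =
         real (card (ssyt (Suc m) \<nu>)) * (\<Prod>i<m. real c - real (\<nu> i) + real i + 1)"
proof -
  let ?\<nu>' = "case_nat c \<nu>"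
  define x where "x i = real (\<nu> i) - real i" for i
  define x' where "x' i = real (?\<nu>' i) - real i" for i
  have "antimono ?\<nu>'"
    using c antimonoD[OF \<nu>(1)] by (auto simp: decseq_Suc_iff split: nat.split)
  moreover have "?\<nu>' i = 0" if "Suc m \<le> i" for i
    using that \<nu>(2) by (auto split: nat.split)
  ultimately have "real (card (ssyt (Suc m) ?\<nu>')) =
      (\<Prod>q<Suc m. 1 / fact q) * (\<Prod>j<Suc m. \<Prod>i<j. x' i - x' j)"
    unfolding x'_def by (rule card_ssyt_weyl)
  also have "(\<Prod>j<Suc m. \<Prod>i<j. x' i - x' j) =
      (\<Prod>j<m. (x' 0 - x' (Suc j)) * (\<Prod>i<j. x' (Suc i) - x' (Suc j)))"
    by (simp add: prod.lessThan_Suc_shift del: prod.lessThan_Suc)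
  also have "\<dots> = (\<Prod>j<m. real c - real (\<nu> j) + real j + 1) * (\<Prod>j<m. \<Prod>i<j. x i - x j)"
    unfolding prod.distrib by (intro arg_cong2[of _ _ _ _ "(*)"] prod.cong) (auto simp: x_def x'_def)
  finally have card': "real (card (ssyt (Suc m) ?\<nu>')) = (\<Prod>q<Suc m. 1 / fact q) *
      ((\<Prod>j<m. real c - real (\<nu> j) + real j + 1) * (\<Prod>j<m. \<Prod>i<j. x i - x j))" .
  have "real (card (ssyt (Suc m) \<nu>)) =
      (\<Prod>q<Suc m. 1 / fact q) * (\<Prod>j<Suc m. \<Prod>i<j. x i - x j)"
    unfolding x_def by (rule card_ssyt_weyl) (use \<nu> in auto)
  also have "(\<Prod>j<Suc m. \<Prod>i<j. x i - x j) =
      (\<Prod>j<m. \<Prod>i<j. x i - x j) * (\<Prod>i<m. real m - real i + real (\<nu> i))"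
    using \<nu>(2)[of m] by (simp add: x_def algebra_simps)
  finally show ?thesis
    using card' by (simp only: mult_ac)
qed

section \<open>Staircase shapes\<close>

lemma antimono_staircase: "antimono (staircase w s k g)"
  using is_partition_staircase by (simp add: is_partition_def)

lemma staircase_eq_0:
  assumes "s * (k - 1) + g \<le> i"
  shows "staircase w s k g i = 0"
proof -
  have "length (concat (map (\<lambda>i. replicate s (w * i)) (rev [1..<k]))) = s * (k - 1)"
    by (simp add: length_concat comp_def rev_map sum_list_triv)
  then show ?thesis
    using assms by (simp add: staircase_def partition_of_list_def)
qed

lemma staircase_Suc_g: "staircase w s k (Suc g) = case_nat (w * k) (staircase w s k g)"
  by (rule ext) (auto simp: staircase_def partition_of_list_def split: nat.split)


text \<open>
  Removing the top block leaves a smaller staircase with a full top block. The equation also holds for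
  \<open>k = 0\<close>, where that smaller staircase consists of zeros.
\<close>

lemma staircase_Suc_k:
  "staircase w s (Suc k) g i = (if i < g then w * Suc k else staircase w s k s (i - g))"
proof (cases k)
  case 0
  then show ?thesis
    by (simp add: staircase_def partition_of_list_def)
next
  case (Suc l)
  then show ?thesis
    by (auto simp: staircase_def partition_of_list_def nth_append simp del: upt_Suc)
       (auto simp: upt_Suc nth_append)
qed

lemma staircase_le: "staircase w s k g i \<le> w * k"
proof (induction k arbitrary: g i)
  case 0
  show ?case
    by (simp add: staircase_def partition_of_list_def)
next
  case (Suc k)
  show ?case
    using le_trans[OF Suc[of s "i - g"]] by (simp add: staircase_Suc_k)
qed

lemma pochhammer_eq_prod_atLeastAtMost:
  fixes z :: real
  shows "(\<Prod>j = 1..w. z + real j) = pochhammer (z + 1) w"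
  by (simp add: pochhammer_prod prod.atLeast1_atMost_eq atLeast0LessThan algebra_simps)

text \<open>
  A block of equal rows contributes a run of consecutive factors to the first product. Passing to the
  next block lowers the row length by \<open>w\<close> and so leaves out \<open>w\<close> consecutive values; the second
  product supplies exactly these gaps, so that all factors together form one rising factorial. The
  free real parameter \<open>c\<close> absorbs the shift by \<open>g\<close> in the induction and makes the identity usable
  for both products of \<open>card_ssyt_prepend_row\<close>.
\<close>

lemma prod_staircase:
  fixes c :: real
  assumes "k = 0 \<or> s * (k - 1) + g \<le> m"
  shows "(\<Prod>i<m. c - real (staircase w s k g i) + real i + 1) *
         (\<Prod>r<k. \<Prod>j = 1..w. c - real (w * k) + real (g + s * r + w * r) + real j) =
         pochhammer (c - real (w * k) + 1) (m + w * k)"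
  using assms
proof (induction k arbitrary: g m c)
  case 0
  then show ?case
    using staircase_le[of w s 0 g] by (simp add: pochhammer_prod atLeast0LessThan algebra_simps)
next
  case (Suc k)
  define a where "a = c - real (w * Suc k) + 1"
  obtain m' where m: "m = g + m'" and m': "k = 0 \<or> s * (k - 1) + s \<le> m'"
    using Suc.prems by (cases k) (auto simp: le_iff_add)
  let ?f = "\<lambda>i. c - real (staircase w s (Suc k) g i) + real i + 1"
  let ?h = "\<lambda>r j. c - real (w * Suc k) + real (g + s * r + w * r) + real j"
  \<comment> \<open>The runs have lengths \<open>g\<close> (top block), \<open>w\<close> (the first gap, \<open>r = 0\<close>) and \<open>m' + w * k\<close> (the rest).\<close>
  have "(\<Prod>i<m. ?f i) = (\<Prod>i<g. ?f i) * (\<Prod>i<m'. ?f (g + i))"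
    unfolding m by (induction m') (auto simp: mult_ac)
  moreover have "(\<Prod>i<g. ?f i) = pochhammer a g"
    unfolding pochhammer_prod a_def by (intro prod.cong) (auto simp: staircase_Suc_k)
  moreover have "(\<Prod>i<m'. ?f (g + i)) =
      (\<Prod>i<m'. (c + real g) - real (staircase w s k s i) + real i + 1)"
    by (intro prod.cong) (auto simp: staircase_Suc_k)
  moreover have "(\<Prod>r<Suc k. \<Prod>j = 1..w. ?h r j) =
      (\<Prod>j = 1..w. ?h 0 j) * (\<Prod>r<k. \<Prod>j = 1..w. ?h (Suc r) j)"
    by (rule prod.lessThan_Suc_shift)
  moreover have "(\<Prod>j = 1..w. ?h 0 j) = pochhammer (a + real g) w"
    unfolding pochhammer_eq_prod_atLeastAtMost a_def by (simp add: algebra_simps)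
  moreover have "(\<Prod>r<k. \<Prod>j = 1..w. ?h (Suc r) j) =
      (\<Prod>r<k. \<Prod>j = 1..w. (c + real g) - real (w * k) + real (s + s * r + w * r) + real j)"
    by (intro prod.cong) (auto simp: algebra_simps)
  moreover have "(\<Prod>i<m'. (c + real g) - real (staircase w s k s i) + real i + 1) *
      (\<Prod>r<k. \<Prod>j = 1..w. (c + real g) - real (w * k) + real (s + s * r + w * r) + real j) =
      pochhammer (a + real g + real w) (m' + w * k)"
    using Suc.IH[OF m', of "c + real g"] by (simp add: a_def algebra_simps)
  ultimately have "(\<Prod>i<m. ?f i) * (\<Prod>r<Suc k. \<Prod>j = 1..w. ?h r j) =
      pochhammer a g * (pochhammer (a + real g) w * pochhammer (a + real g + real w) (m' + w * k))"
    by (simp only: mult_ac)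
  also have "\<dots> = pochhammer a (m + w * Suc k)"
  proof -
    have "m + w * Suc k = g + (w + (m' + w * k))"
      by (simp add: m)
    then show ?thesis
      by (simp only: pochhammer_product')
  qed
  finally show ?case
    by (simp only: a_def)
qed

text \<open>
  The factors of the new first row, completed by the denominators of the final formula.
\<close>

lemma prod_first_row_factors:
  assumes "k > 0" "s * (k - 1) + g \<le> m"
  shows "(\<Prod>i<m. real (w * k) - real (staircase w s k g i) + real i + 1) *
         (\<Prod>r<k. \<Prod>j = 1..w. real (g + s * r + w * r) + real j) = fact (m + w * k)"
  using prod_staircase[of k s g m "real (w * k)" w] assms by (simp add: pochhammer_fact)

text \<open>
  The factors of the vacated last row, completed by the numerators of the final formula. Up to sign,
  this is the same gap-filling identity at \<open>c = - 1 - m\<close>: there the factor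
  \<open>c - \<nu> i + i + 1\<close> is the negative of \<open>m - i + \<nu> i\<close>. Since the completed product is again
  \<open>fact (m + w * k)\<close>, the quotient of the two products only depends on what was filled in.
\<close>

lemma prod_last_row_factors:
  assumes "k > 0" "s * (k - 1) + g \<le> m"
  shows "(\<Prod>i<m. real m - real i + real (staircase w s k g i)) *
         (\<Prod>r<k. \<Prod>j = 1..w. real m - real g - real (s * (k - 1)) + real (s * r + w * r) + real j) =
         fact (m + w * k)"
proof -
  define N where "N = m + w * k"
  let ?c = "- 1 - real m"
  let ?h = "\<lambda>r j. real m - real g - real (s * (k - 1)) + real (s * r + w * r) + real j"
  let ?h' = "\<lambda>r j. ?c - real (w * k) + real (g + s * r + w * r) + real j"
  have rows: "(\<Prod>i<m. ?c - real (staircase w s k g i) + real i + 1) =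
      (-1) ^ m * (\<Prod>i<m. real m - real i + real (staircase w s k g i))"
    by (subst prod_uminus[of _ "{..<m}", simplified, symmetric]) (simp add: algebra_simps)
  \<comment> \<open>The sign change reverses the order in which the gaps are listed.\<close>
  have "(\<Prod>r<k. \<Prod>j = 1..w. ?h' r j) = (\<Prod>r<k. \<Prod>j = 1..w. ?h' (k - Suc r) (w + 1 - j))"
    by (subst prod.nat_diff_reindex[symmetric], subst prod.atLeastAtMost_rev) (simp add: add.commute)
  also have "\<dots> = (\<Prod>r<k. \<Prod>j = 1..w. - ?h r j)"
  proof (intro prod.cong refl)
    fix r j assume "r \<in> {..<k}" "j \<in> {1..w}"
    moreover from this obtain l where "k = Suc (r + l)"
      by (auto simp: less_iff_Suc_add)
    ultimately show "?h' (k - Suc r) (w + 1 - j) = - ?h r j"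
      by (simp add: of_nat_diff algebra_simps)
  qed
  also have "\<dots> = (-1) ^ (w * k) * (\<Prod>r<k. \<Prod>j = 1..w. ?h r j)"
    unfolding prod_uminus prod.distrib by (simp add: power_mult)
  finally have strips: "(\<Prod>r<k. \<Prod>j = 1..w. ?h' r j) = \<dots>" .
  have "(-1) ^ N * ((\<Prod>i<m. real m - real i + real (staircase w s k g i)) *
          (\<Prod>r<k. \<Prod>j = 1..w. ?h r j)) = pochhammer (- real N) N"
    using prod_staircase[of k s g m ?c w] assms rows strips by (simp add: N_def power_add algebra_simps)
  also have "\<dots> = (-1) ^ N * fact N"
    by (simp add: pochhammer_same)
  finally show ?thesis
    by (simp add: N_def)
qed


lemma card_ssyt_staircase_Suc:
  assumes "k > 0" "s * (k - 1) + g \<le> m"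
  shows "real (card (ssyt (Suc m) (staircase w s k (Suc g)))) /
         real (card (ssyt (Suc m) (staircase w s k g))) =
         (\<Prod>r<k. \<Prod>j = 1..w.
            (real m - real g - real (s * (k - 1)) + real (s * r + w * r) + real j) /
            (real (g + s * r + w * r) + real j))"
proof -
  let ?\<nu> = "staircase w s k g"
  let ?Num = "\<Prod>i<m. real (w * k) - real (?\<nu> i) + real i + 1"
  let ?Den = "\<Prod>i<m. real m - real i + real (?\<nu> i)"
  let ?P = "\<Prod>r<k. \<Prod>j = 1..w. real (g + s * r + w * r) + real j"
  let ?Q = "\<Prod>r<k. \<Prod>j = 1..w.
      real m - real g - real (s * (k - 1)) + real (s * r + w * r) + real j"
  have zero: "?\<nu> i = 0" if "m \<le> i" for i
    using that assms by (intro staircase_eq_0) auto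
  have "real (card (ssyt (Suc m) (staircase w s k (Suc g)))) * ?Den =
      real (card (ssyt (Suc m) ?\<nu>)) * ?Num"
    unfolding staircase_Suc_g
    by (rule card_ssyt_prepend_row[OF antimono_staircase zero staircase_le])
  moreover have "?Num * ?P = fact (m + w * k)" "?Den * ?Q = fact (m + w * k)"
    using prod_first_row_factors[OF assms] prod_last_row_factors[OF assms] by blast+
  moreover have "(fact (m + w * k) :: real) \<noteq> 0"
    by simp
  moreover have "real (card (ssyt (Suc m) ?\<nu>)) \<noteq> 0"
    using card_ssyt_pos[OF antimono_staircase, of "Suc m"] zero by simp
  moreover have "x / y = Q / P" if "x * D = y * N" "N * P = F" "D * Q = F" "F \<noteq> 0" "y \<noteq> 0"
    for x y D N P Q F :: real
    using that by (auto simp: frac_eq_eq) (metis mult.assoc mult.commute mult_left_cancel)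
  ultimately have "real (card (ssyt (Suc m) (staircase w s k (Suc g)))) /
      real (card (ssyt (Suc m) ?\<nu>)) = ?Q / ?P"
    by blast
  then show ?thesis
    by (simp only: prod_dividef)
qed

lemma card_ssyt_staircase_add:
  assumes "k > 0" "s * (k - 1) + g + d \<le> n"
  shows "real (card (ssyt n (staircase w s k (g + d)))) / real (card (ssyt n (staircase w s k g))) =
         (\<Prod>v<d. \<Prod>r<k. \<Prod>j = 1..w.
            (real n - 1 - real (g + v) - real (s * (k - 1)) + real (s * r + w * r) + real j) /
            (real (g + v + s * r + w * r) + real j))"
  using assms(2)
proof (induction d)
  case 0
  have "card (ssyt n (staircase w s k g)) > 0"
    using 0 by (intro card_ssyt_pos antimono_staircase staircase_eq_0) auto
  then show ?case by simp
next
  case (Suc d)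
  let ?card = "\<lambda>g. real (card (ssyt n (staircase w s k g)))"
  obtain m where n: "n = Suc m" and m: "s * (k - 1) + (g + d) \<le> m"
    using Suc.prems by (cases n) auto
  have "card (ssyt n (staircase w s k (g + d))) > 0"
    using Suc.prems by (intro card_ssyt_pos antimono_staircase staircase_eq_0) auto
  then have split: "?card (g + Suc d) / ?card g =
      (?card (g + d) / ?card g) * (?card (Suc (g + d)) / ?card (g + d))"
    by simp
  have "?card (Suc (g + d)) / ?card (g + d) = (\<Prod>r<k. \<Prod>j = 1..w.
      (real n - 1 - real (g + d) - real (s * (k - 1)) + real (s * r + w * r) + real j) /
      (real (g + d + s * r + w * r) + real j))"
    using card_ssyt_staircase_Suc[OF \<open>k > 0\<close> m, of w] by (simp add: n)
  moreover have "s * (k - 1) + g + d \<le> n"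
    using Suc.prems by simp
  ultimately show ?case
    by (simp only: split Suc.IH prod.lessThan_Suc)
qed

theorem corollary7p12:
  fixes k w s n g h :: nat
  assumes "k > 0" and "w > 0" and "s > 0" and "n > 0"
    and "g < h" and "h \<le> s"
    and "n \<ge> part_length (staircase w s k h)"
  shows "schur n (staircase w s k h) (\<lambda>_. 1 :: real) / schur n (staircase w s k g) (\<lambda>_. 1)
       = (\<Prod>r\<in>{0..k - 1}. \<Prod>j\<in>{1..w}. \<Prod>v\<in>{0..h - g - 1}.
            (real n - real s * (real k - 1) - real h + real s * real r + real v + real j
               + real w * real r)
            / (real g + real s * real r + real v + real j + real w * real r))"
proof -
  obtain d where h: "h = g + d" and d: "d > 0"
    using \<open>g < h\<close> less_imp_add_positive by blast
  have n: "s * (k - 1) + g + d \<le> n"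
    using assms by (simp add: part_length_staircase h)
  let ?N = "\<lambda>r j v. real n - real s * (real k - 1) - real h + real s * real r + real v + real j
               + real w * real r"
  let ?D = "\<lambda>r j v. real g + real s * real r + real v + real j + real w * real r"
  have rev: "(\<Prod>v<d. ?N r j (d - Suc v)) = (\<Prod>v<d. ?N r j v)" for r j
    by (rule prod.nat_diff_reindex)
  have "schur n (staircase w s k h) (\<lambda>_. 1 :: real) / schur n (staircase w s k g) (\<lambda>_. 1) =
      (\<Prod>v<d. \<Prod>r<k. \<Prod>j = 1..w.
        (real n - 1 - real (g + v) - real (s * (k - 1)) + real (s * r + w * r) + real j) /
        (real (g + v + s * r + w * r) + real j))"
    unfolding h schur_ones by (rule card_ssyt_staircase_add[OF \<open>k > 0\<close> n])
  \<comment> \<open>The addition of row number \<open>v\<close> contributes the numerator that the formula lists at \<open>d - Suc v\<close>.\<close>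
  also have "\<dots> = (\<Prod>v<d. \<Prod>r<k. \<Prod>j = 1..w. ?N r j (d - Suc v) / ?D r j v)"
    using \<open>k > 0\<close> by (intro prod.cong refl arg_cong2[of _ _ _ _ "(/)"])
      (auto simp: h of_nat_diff algebra_simps)
  also have "\<dots> = (\<Prod>r<k. \<Prod>j = 1..w. \<Prod>v<d. ?N r j (d - Suc v) / ?D r j v)"
    by (subst prod.swap, subst (2) prod.swap) (rule refl)
  also have "\<dots> = (\<Prod>r<k. \<Prod>j = 1..w. \<Prod>v<d. ?N r j v / ?D r j v)"
    by (simp only: prod_dividef rev)
  also have "{..<k} = {0..k - 1}"
    using \<open>k > 0\<close> by auto
  also have "{..<d} = {0..h - g - 1}"
    using d by (auto simp: h)
  finally show ?thesis .
qed

end
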